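(* Let $A\in\mathbb{R}^{n\times n}$ be nonsingular, $u,v,b\in\mathbb{R}^n$, and suppose that the linear systems $Ay=b$ and $Az=u$ are solved normwise backward stably with stability constant $c_s$. Let $\widehat x$ be the solution of $(A+uv^T)x=b$ computed by the Sherman--Morrison algorithm (SM) in floating point arithmetic with unit roundoff $\epsilon_M$, and let $\widehat y$ be the computed solution of $Ay=b$ in that algorithm. Then there exist $\Delta A,\Delta F\in\mathbb{R}^{n\times n}$ and $\Delta u,\Delta v,\Delta b\in\mathbb{R}^n$ such that $$\Big((A+\Delta A)+(u+\Delta u)(v+\Delta v)^T\Big)\widehat x=b+\Delta b+\Delta F\,\widehat y,$$ where \begin{align*} \|\Delta A\|&\le\big((2+c_s)\epsilon_M+\mathcal O(\epsilon_M^2)\big)\|A\|,\\ \|\Delta u\|&\le c_s\epsilon_M\|u\|,\\ \|\Delta v\|&\le\big((n+2)\epsilon_M+\mathcal O(\epsilon_M^2)\big)\|v\|,\\ \|\Delta b\|&\le c_s\epsilon_M\|b\|,\\ \|\Delta F\|&\le\epsilon_M\big((2c_s+1)\|A\|+(2n+3)\|u\|\,\|v\|\big)+\mathcal O(\epsilon_M^2). \end{align*}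
   Context: Norms: $\|\cdot\|$ is the Euclidean vector norm and the induced matrix 2-norm. Algorithm SM (for $(A+uv^T)x=b$): (1) solve $Ay=b$ for $y$; (2) solve $Az=u$ for $z$; (3) compute $\alpha=v^Ty$, $\beta=1+v^Tz$, $\theta=\alpha/\beta$; (4) output $x=y-z\theta$. Hats denote the quantities actually computed in floating point arithmetic. The matrix $A+uv^T$ is nonsingular (equivalently, the exact $\beta$ is nonzero), and the algorithm runs to completion, so the computed $\widehat\beta$ is nonzero. Floating point model: $\epsilon_M$ is the unit roundoff, $n\epsilon_M<1$, $\gamma_n=n\epsilon_M/(1-n\epsilon_M)$. Every scalar operation satisfies $\mathrm{fl}(a\circ b)=(a\circ b)(1+\delta)$, $|\delta|\le\epsilon_M$, $\circ\in\{+,-,\times,/\}$ (vector operations being performed entrywise). A computed inner product satisfies $\mathrm{fl}(v^Tw)=v^T(I+D)w$ with $D$ diagonal and $|D|\le\gamma_n I$ entrywise. Normwise backward stable solve with constant $c_s$ (a fixed constant independent of $\epsilon_M$): for a right-hand side $g$, the computed solution $\widehat s$ of $As=g$ satisfies $(A+\delta A)\widehat s=g+\delta g$ for some $\delta A,\delta g$ (which may differ from solve to solve) with $\|\delta A\|\le c_s\epsilon_M\|A\|$ and $\|\delta g\|\le c_s\epsilon_M\|g\|$. $\mathcal O(\epsilon_M^2)$ denotes a quantity bounded in absolute value by $C\epsilon_M^2$ for all sufficiently small $\epsilon_M>0$, where $C$ and the smallness threshold may depend on $n,c_s,A,u,v,b$ but not on $\epsilon_M$ or on the particular rounding errors committed.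 *)

theory Defs
  imports "HOL-Analysis.Analysis" "HOL-Library.Landau_Symbols"
begin

text \<open>The induced matrix 2-norm.  The type-class \<open>norm\<close> on matrices is the Frobenius norm.\<close>
definition mnorm :: "real^'n^'m \<Rightarrow> real"
  where "mnorm M = onorm (\<lambda>x. M *v x)"

definition outer :: "real^'m \<Rightarrow> real^'n \<Rightarrow> real^'n^'m"
  where "outer u v = (\<chi> i j. u $ i * v $ j)"

definition gamma_fl :: "nat \<Rightarrow> real \<Rightarrow> real"
  where "gamma_fl n eps = real n * eps / (1 - real n * eps)"

text \<open>
  Floating point arithmetic is modelled by relations between exact and computed values, so that a
  universally quantified computed value ranges over all rounding errors the model admits.
  \<open>fl_rel eps s t\<close>: \<open>t\<close> is an admissible computed value of a scalar operation with
  exact result \<open>s\<close>.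
\<close>
definition fl_rel :: "real \<Rightarrow> real \<Rightarrow> real \<Rightarrow> bool"
  where "fl_rel eps s t \<longleftrightarrow> (\<exists>\<delta>. \<bar>\<delta>\<bar> \<le> eps \<and> t = s * (1 + \<delta>))"

definition fl_vec_rel :: "real \<Rightarrow> real^'n \<Rightarrow> real^'n \<Rightarrow> bool"
  where "fl_vec_rel eps s t \<longleftrightarrow> (\<forall>i. fl_rel eps (s $ i) (t $ i))"

text \<open>The entrywise bound by \<open>\<gamma>\<^sub>n I\<close> forces \<open>D\<close> to be diagonal.\<close>
definition fl_inner_rel :: "real \<Rightarrow> real^'n \<Rightarrow> real^'n \<Rightarrow> real \<Rightarrow> bool"
  where "fl_inner_rel eps v w t \<longleftrightarrow>
    (\<exists>D :: real^'n^'n.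
       (\<forall>i j. \<bar>D $ i $ j\<bar> \<le> gamma_fl CARD('n) eps * (mat 1 :: real^'n^'n) $ i $ j) \<and>
       t = v \<bullet> ((mat 1 + D) *v w))"

definition backward_stable_solution ::
    "real \<Rightarrow> real \<Rightarrow> real^'n^'n \<Rightarrow> real^'n \<Rightarrow> real^'n \<Rightarrow> bool"
  where "backward_stable_solution c eps A g s \<longleftrightarrow>
    (\<exists>\<delta>A \<delta>g. (A + \<delta>A) *v s = g + \<delta>g \<and>
       mnorm \<delta>A \<le> c * eps * mnorm A \<and> norm \<delta>g \<le> c * eps * norm g)"

text \<open>
  \<open>SM_computed c eps A u v b y x\<close>: some floating point run of the Sherman--Morrison algorithm
  for \<open>(A + u v\<^sup>T) x = b\<close> that completes (\<open>\<beta> \<noteq> 0\<close>) computes \<open>y\<close> as solution of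
  \<open>A y = b\<close> and returns \<open>x\<close>.  All variables denote computed quantities; \<open>p\<close> and \<open>w\<close> are the
  computed \<open>v\<^sup>T z\<close> and \<open>z \<theta>\<close>.
\<close>
definition SM_computed ::
    "real \<Rightarrow> real \<Rightarrow> real^'n^'n \<Rightarrow> real^'n \<Rightarrow> real^'n \<Rightarrow> real^'n \<Rightarrow> real^'n \<Rightarrow> real^'n \<Rightarrow> bool"
  where "SM_computed c eps A u v b y x \<longleftrightarrow>
    (\<exists>z \<alpha> p \<beta> \<theta> w.
       backward_stable_solution c eps A b y \<and>
       backward_stable_solution c eps A u z \<and>
       fl_inner_rel eps v y \<alpha> \<and>
       fl_inner_rel eps v z p \<and>
       fl_rel eps (1 + p) \<beta> \<and>
       \<beta> \<noteq> 0 \<and>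
       fl_rel eps (\<alpha> / \<beta>) \<theta> \<and>
       fl_vec_rel eps (\<theta> *\<^sub>R z) w \<and>
       fl_vec_rel eps (y - w) x)"

end

theory Submission
  imports Defs "HOL-Real_Asymp.Real_Asymp"
begin

text \<open>
  Every rounding error is a factor close to \<open>1\<close>, acting entrywise on vectors, and the entrywise
  product can be moved onto \<open>A\<close> (scaling its columns) or onto \<open>v\<close>.  Undoing the last two steps
  gives \<open>y - w = d\<^sub>x x\<close> and \<open>\<theta> z = d\<^sub>w w\<close>, hence \<open>\<theta> z = d\<^sub>w (y - d\<^sub>x x)\<close>.  With
  \<open>E\<^sub>2\<close> and \<open>\<Delta>u\<close> the backward errors of the solve for \<open>z\<close> and \<open>u' = u + \<Delta>u\<close>, this is
  substituted into \<open>(A + E\<^sub>2) (\<theta> z) = \<theta> u'\<close> and into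
  \<open>\<theta> = \<rho> v\<^sup>T (d\<^sub>a y) - v\<^sup>T (d\<^sub>p \<theta> z)\<close>, which is the computed form of
  \<open>\<theta> (1 + v\<^sup>T z) = v\<^sup>T y\<close>.  The terms in \<open>x\<close> yield the perturbed matrix; those in \<open>y\<close> yield
  \<open>b + \<Delta>b\<close> plus a residual \<open>\<Delta>F y\<close>.  No condition number enters because \<open>\<theta>\<close> is eliminated
  exactly.
\<close>

section \<open>Diagonal scaling and the induced 2-norm\<close>

text \<open>This is the product \<open>M diag(d)\<close>. Diagonal matrices are represented by
  vectors acting through the entrywise product, whose unit \<open>1\<close> is the all-ones
  vector.\<close>

definition scale_cols :: "real^'n^'m \<Rightarrow> real^'n \<Rightarrow> real^'n^'m"
  where "scale_cols M d = (\<chi> i j. M $ i $ j * d $ j)"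

lemma scale_cols_mult_vec: "scale_cols M d *v x = M *v (d * x)"
  by (simp add: scale_cols_def matrix_vector_mult_def vec_eq_iff mult.assoc)

lemma scale_cols_minus_self: "scale_cols M d - M = scale_cols M (d - 1)"
  by (simp add: scale_cols_def vec_eq_iff algebra_simps)

lemma scale_cols_add_left: "scale_cols (M + N) d = scale_cols M d + scale_cols N d"
  by (simp add: scale_cols_def vec_eq_iff algebra_simps)

lemma outer_mult_vec: "outer u v *v x = (v \<bullet> x) *\<^sub>R u"
  by (simp add: outer_def matrix_vector_mult_def vec_eq_iff inner_vec_def sum_distrib_left
      mult_ac)

lemma norm_times_vec_le:
  fixes d x :: "real^'n"
  assumes "\<And>i. \<bar>d $ i\<bar> \<le> K"
  shows "norm (d * x) \<le> K * norm x"
proof -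
  \<comment> \<open>\<open>undefined\<close> is merely some index: index types are nonempty, so
    \<open>K\<close> dominates an absolute value.\<close>
  have "0 \<le> K"
    using assms[of undefined] by linarith
  have "norm (d * x) \<le> norm (K *\<^sub>R x)"
    by (rule norm_le_componentwise_cart)
      (auto simp: abs_mult \<open>0 \<le> K\<close> intro: mult_right_mono assms)
  with \<open>0 \<le> K\<close> show ?thesis
    by simp
qed

lemma mnorm_nonneg: "0 \<le> mnorm M"
  unfolding mnorm_def by (rule onorm_pos_le) simp

lemma mnorm_mult_vec_le: "norm (M *v x) \<le> mnorm M * norm x"
  unfolding mnorm_def by (rule onorm) simp

lemma mnorm_le: "mnorm M \<le> B" if "\<And>x. norm (M *v x) \<le> B * norm x"
  unfolding mnorm_def by (rule onorm_le) (use that in auto)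

lemma mnorm_add_le: "mnorm (M + N) \<le> mnorm M + mnorm N"
  using onorm_triangle[of "(*v) M" "(*v) N"]
  by (simp add: mnorm_def matrix_vector_mult_add_rdistrib)

lemma mnorm_diff_le: "mnorm (M - N) \<le> mnorm M + mnorm N"
proof (rule mnorm_le)
  fix x
  have "norm ((M - N) *v x) \<le> norm (M *v x) + norm (N *v x)"
    by (simp add: matrix_vector_mult_diff_rdistrib norm_triangle_ineq4)
  also have "\<dots> \<le> (mnorm M + mnorm N) * norm x"
    using mnorm_mult_vec_le[of M x] mnorm_mult_vec_le[of N x] by (simp add: distrib_right)
  finally show "norm ((M - N) *v x) \<le> (mnorm M + mnorm N) * norm x" .
qed

lemma mnorm_outer_le: "mnorm (outer u v) \<le> norm u * norm v"
proof (rule mnorm_le)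
  fix x
  show "norm (outer u v *v x) \<le> norm u * norm v * norm x"
    using mult_right_mono[OF Cauchy_Schwarz_ineq2[of v x] norm_ge_zero[of u]]
    by (simp add: outer_mult_vec mult_ac)
qed

lemma mnorm_scale_cols_le:
  assumes "\<And>i. \<bar>d $ i\<bar> \<le> K"
  shows "mnorm (scale_cols M d) \<le> K * mnorm M"
proof (rule mnorm_le)
  fix x
  have "norm (scale_cols M d *v x) \<le> mnorm M * norm (d * x)"
    by (simp add: scale_cols_mult_vec mnorm_mult_vec_le)
  also have "\<dots> \<le> mnorm M * (K * norm x)"
    by (intro mult_left_mono norm_times_vec_le assms mnorm_nonneg)
  finally show "norm (scale_cols M d *v x) \<le> K * mnorm M * norm x"
    by (simp add: mult_ac)
qed

text \<open>
  Relative errors are bounded in the form \<open>\<bar>p - 1\<bar> \<le> P - 1\<close>, so that the bounds \<open>P\<close> multiply.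
\<close>
lemma abs_mult_minus_one_le:
  fixes p q :: real
  assumes "\<bar>p - 1\<bar> \<le> P - 1" "\<bar>q - 1\<bar> \<le> Q - 1"
  shows "\<bar>p * q - 1\<bar> \<le> P * Q - 1"
proof -
  have "p * q - 1 = (p - 1) * (q - 1) + (p - 1) + (q - 1)"
    by (simp add: algebra_simps)
  also have "\<bar>\<dots>\<bar> \<le> \<bar>p - 1\<bar> * \<bar>q - 1\<bar> + \<bar>p - 1\<bar> + \<bar>q - 1\<bar>"
    by (simp flip: abs_mult)
  also have "\<dots> \<le> (P - 1) * (Q - 1) + (P - 1) + (Q - 1)"
    using assms by (intro add_mono mult_mono) auto
  finally show ?thesis
    by (simp add: algebra_simps)
qed

section \<open>Rounding errors as factors near 1\<close>

lemma fl_relE: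
  assumes "fl_rel eps s t"
  obtains r where "t = r * s" "\<bar>r - 1\<bar> \<le> (1 + eps) - 1"
proof -
  from assms obtain \<delta> where "\<bar>\<delta>\<bar> \<le> eps" "t = s * (1 + \<delta>)"
    unfolding fl_rel_def by blast
  then show thesis
    by (intro that[of "1 + \<delta>"]) auto
qed

text \<open>Solving for the exact value gives the factor \<open>1 / (1 + \<delta>)\<close>, whose
  distance from 1 is largest at \<open>\<delta> = - eps\<close>.\<close>

lemma fl_rel_inverseE:
  assumes "fl_rel eps s t" "eps < 1"
  obtains r where "s = r * t" "\<bar>r - 1\<bar> \<le> 1 / (1 - eps) - 1"
proof -
  from assms obtain \<delta> where \<delta>: "\<bar>\<delta>\<bar> \<le> eps" "t = s * (1 + \<delta>)"
    unfolding fl_rel_def by blast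
  have pos: "0 < 1 + \<delta>" "0 < 1 - eps"
    using \<delta> assms by linarith+
  have "1 / (1 + \<delta>) - 1 = - \<delta> / (1 + \<delta>)"
    using pos by (simp add: field_simps)
  then have "\<bar>1 / (1 + \<delta>) - 1\<bar> = \<bar>\<delta>\<bar> / (1 + \<delta>)"
    using pos by (simp add: abs_divide)
  also have "\<dots> \<le> eps / (1 - eps)"
    using \<delta> pos by (intro frac_le) linarith+
  also have "\<dots> = 1 / (1 - eps) - 1"
    using pos by (simp add: field_simps)
  finally show thesis
    using \<delta>(2) pos by (intro that[of "1 / (1 + \<delta>)"]) auto
qed

lemma fl_vec_rel_inverseE:
  fixes s t :: "real^'n"
  assumes "fl_vec_rel eps s t" "eps < 1"
  obtains d where "s = d * t" "\<And>i. \<bar>d $ i - 1\<bar> \<le> 1 / (1 - eps) - 1"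
proof -
  have "\<exists>r. s $ i = r * t $ i \<and> \<bar>r - 1\<bar> \<le> 1 / (1 - eps) - 1" for i
    using assms fl_rel_inverseE unfolding fl_vec_rel_def by metis
  then obtain d where d: "\<And>i. s $ i = d i * t $ i \<and> \<bar>d i - 1\<bar> \<le> 1 / (1 - eps) - 1"
    by metis
  show thesis
    by (rule that[of "\<chi> i. d i"]) (use d in \<open>auto simp: vec_eq_iff\<close>)
qed

text \<open>A diagonal \<open>D\<close> makes \<open>mat 1 + D\<close> an entrywise factor, and
  \<open>1 + gamma_fl n eps = 1 / (1 - n * eps)\<close> puts its bound into the form
  \<open>P - 1\<close>.\<close>

lemma fl_inner_relE:
  fixes v w :: "real^'n"
  assumes "fl_inner_rel eps v w t" "real CARD('n) * eps < 1"
  obtains d where "t = v \<bullet> (d * w)" "\<And>i. \<bar>d $ i - 1\<bar> \<le> 1 / (1 - real CARD('n) * eps) - 1"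
proof -
  from assms(1) obtain D :: "real^'n^'n" where
    D: "\<And>i j. \<bar>D $ i $ j\<bar> \<le> gamma_fl CARD('n) eps * (mat 1 :: real^'n^'n) $ i $ j"
    and t: "t = v \<bullet> ((mat 1 + D) *v w)"
    unfolding fl_inner_rel_def by blast
  have offdiag: "D $ i $ j = 0" if "i \<noteq> j" for i j
    using D[of i j] that by (simp add: mat_def)
  have diag: "\<bar>D $ i $ i\<bar> \<le> 1 / (1 - real CARD('n) * eps) - 1" for i
    using D[of i i] assms(2) by (simp add: mat_def gamma_fl_def field_simps)
  have "mat 1 + D = scale_cols (mat 1) (\<chi> i. 1 + D $ i $ i)"
    using offdiag by (auto simp: scale_cols_def mat_def vec_eq_iff)
  then have "(mat 1 + D) *v w = (\<chi> i. 1 + D $ i $ i) * w"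
    by (simp add: scale_cols_mult_vec)
  then show thesis
    using t diag by (intro that[of "\<chi> i. 1 + D $ i $ i"]) auto
qed

text \<open>Of the computed quantities only \<open>y\<close>, \<open>x\<close> and
  \<open>\<theta>\<close> survive. Inner products and the division are read forwards; the addition
  in \<beta>, the product with \<theta> and the final subtraction are read backwards. The factor
  \<open>\<rho>\<close> joins the division with the inverted addition.\<close>

lemma SM_computedE:
  fixes A :: "real^'n^'n" and u v b x y :: "real^'n"
  assumes "0 < eps" "real CARD('n) * eps < 1" "SM_computed c eps A u v b y x"
  obtains E\<^sub>1 E\<^sub>2 :: "real^'n^'n" and \<Delta>b \<Delta>u d\<^sub>a d\<^sub>p d\<^sub>w d\<^sub>x :: "real^'n" and \<rho> \<theta> :: real where
    "(A + E\<^sub>1) *v y = b + \<Delta>b"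
    "(A + E\<^sub>2) *v (d\<^sub>w * (y - d\<^sub>x * x)) = \<theta> *\<^sub>R (u + \<Delta>u)"
    "\<theta> = \<rho> * (v \<bullet> (d\<^sub>a * y)) - v \<bullet> (d\<^sub>p * (d\<^sub>w * (y - d\<^sub>x * x)))"
    "mnorm E\<^sub>1 \<le> c * eps * mnorm A" "mnorm E\<^sub>2 \<le> c * eps * mnorm A"
    "norm \<Delta>b \<le> c * eps * norm b" "norm \<Delta>u \<le> c * eps * norm u"
    "\<bar>\<rho> - 1\<bar> \<le> (1 + eps) * (1 / (1 - eps)) - 1"
    "\<And>i. \<bar>d\<^sub>a $ i - 1\<bar> \<le> 1 / (1 - real CARD('n) * eps) - 1"
    "\<And>i. \<bar>d\<^sub>p $ i - 1\<bar> \<le> 1 / (1 - real CARD('n) * eps) - 1"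
    "\<And>i. \<bar>d\<^sub>w $ i - 1\<bar> \<le> 1 / (1 - eps) - 1"
    "\<And>i. \<bar>d\<^sub>x $ i - 1\<bar> \<le> 1 / (1 - eps) - 1"
proof -
  have "eps \<le> real CARD('n) * eps"
    using \<open>0 < eps\<close> by simp
  with assms(2) have "eps < 1"
    by linarith
  from assms(3) obtain z \<alpha> p \<beta> \<theta> w where
    y: "backward_stable_solution c eps A b y" and
    z: "backward_stable_solution c eps A u z" and
    \<alpha>: "fl_inner_rel eps v y \<alpha>" and p: "fl_inner_rel eps v z p" and
    \<beta>: "fl_rel eps (1 + p) \<beta>" "\<beta> \<noteq> 0" and \<theta>: "fl_rel eps (\<alpha> / \<beta>) \<theta>" and
    w: "fl_vec_rel eps (\<theta> *\<^sub>R z) w" and x: "fl_vec_rel eps (y - w) x"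
    unfolding SM_computed_def by blast
  obtain E\<^sub>1 \<Delta>b where E\<^sub>1: "(A + E\<^sub>1) *v y = b + \<Delta>b"
    "mnorm E\<^sub>1 \<le> c * eps * mnorm A" "norm \<Delta>b \<le> c * eps * norm b"
    using y unfolding backward_stable_solution_def by blast
  obtain E\<^sub>2 \<Delta>u where E\<^sub>2: "(A + E\<^sub>2) *v z = u + \<Delta>u"
    "mnorm E\<^sub>2 \<le> c * eps * mnorm A" "norm \<Delta>u \<le> c * eps * norm u"
    using z unfolding backward_stable_solution_def by blast
  obtain d\<^sub>a where d\<^sub>a: "\<alpha> = v \<bullet> (d\<^sub>a * y)"
    "\<And>i. \<bar>d\<^sub>a $ i - 1\<bar> \<le> 1 / (1 - real CARD('n) * eps) - 1"
    using fl_inner_relE[OF \<alpha> assms(2)] by metis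
  obtain d\<^sub>p where d\<^sub>p: "p = v \<bullet> (d\<^sub>p * z)"
    "\<And>i. \<bar>d\<^sub>p $ i - 1\<bar> \<le> 1 / (1 - real CARD('n) * eps) - 1"
    using fl_inner_relE[OF p assms(2)] by metis
  obtain r\<^sub>1 where r\<^sub>1: "1 + p = r\<^sub>1 * \<beta>" "\<bar>r\<^sub>1 - 1\<bar> \<le> 1 / (1 - eps) - 1"
    using fl_rel_inverseE[OF \<beta>(1) \<open>eps < 1\<close>] .
  obtain r\<^sub>2 where r\<^sub>2: "\<theta> = r\<^sub>2 * (\<alpha> / \<beta>)" "\<bar>r\<^sub>2 - 1\<bar> \<le> (1 + eps) - 1"
    using fl_relE[OF \<theta>] .
  obtain d\<^sub>w where d\<^sub>w: "\<theta> *\<^sub>R z = d\<^sub>w * w" "\<And>i. \<bar>d\<^sub>w $ i - 1\<bar> \<le> 1 / (1 - eps) - 1"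
    using fl_vec_rel_inverseE[OF w \<open>eps < 1\<close>] by metis
  obtain d\<^sub>x where d\<^sub>x: "y - w = d\<^sub>x * x" "\<And>i. \<bar>d\<^sub>x $ i - 1\<bar> \<le> 1 / (1 - eps) - 1"
    using fl_vec_rel_inverseE[OF x \<open>eps < 1\<close>] by metis
  have w_eq: "w = y - d\<^sub>x * x"
    using d\<^sub>x(1) by (simp add: algebra_simps)
  \<comment> \<open>Multiplying by \<theta> instead of dividing by \<open>1 + p\<close> lets the
    computed \<beta> cancel: \<open>1 + p\<close> is \<open>r\<^sub>1 * \<beta>\<close> and \<theta>
    is \<open>r\<^sub>2 * (\<alpha> / \<beta>)\<close>.\<close>
  have "\<theta> + v \<bullet> (d\<^sub>p * (\<theta> *\<^sub>R z)) = \<theta> * (1 + p)"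
  proof -
    have "d\<^sub>p * (\<theta> *\<^sub>R z) = \<theta> *\<^sub>R (d\<^sub>p * z)"
      by (simp add: vec_eq_iff)
    then show ?thesis
      by (simp add: d\<^sub>p(1) distrib_left)
  qed
  also have "\<dots> = r\<^sub>2 * r\<^sub>1 * \<alpha>"
    using \<open>\<beta> \<noteq> 0\<close> by (simp add: r\<^sub>1(1) r\<^sub>2(1))
  finally have \<theta>_eq: "\<theta> = r\<^sub>2 * r\<^sub>1 * (v \<bullet> (d\<^sub>a * y)) - v \<bullet> (d\<^sub>p * (d\<^sub>w * (y - d\<^sub>x * x)))"
    by (simp add: d\<^sub>a(1) d\<^sub>w(1) w_eq)
  have z_eq: "(A + E\<^sub>2) *v (d\<^sub>w * (y - d\<^sub>x * x)) = \<theta> *\<^sub>R (u + \<Delta>u)"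
    by (simp flip: E\<^sub>2(1) d\<^sub>w(1) w_eq add: matrix_vector_mult_scaleR)
  show thesis
    using that[OF E\<^sub>1(1) z_eq \<theta>_eq E\<^sub>1(2) E\<^sub>2(2) E\<^sub>1(3) E\<^sub>2(3)
        abs_mult_minus_one_le[OF r\<^sub>2(2) r\<^sub>1(2)] d\<^sub>a(2) d\<^sub>p(2) d\<^sub>w(2) d\<^sub>x(2)] .
qed

section \<open>Backward error with explicit bounds, before expansion in \<open>eps\<close>\<close>

lemma SM_backward_error:
  fixes A :: "real^'n^'n" and u v b x y :: "real^'n" and c eps :: real
  defines "k \<equiv> 1 / (1 - eps)" and "g \<equiv> 1 / (1 - real CARD('n) * eps)"
  assumes "0 < eps" "real CARD('n) * eps < 1" "SM_computed c eps A u v b y x"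
  shows "\<exists>(\<Delta>A :: real^'n^'n) (\<Delta>F :: real^'n^'n) (\<Delta>u :: real^'n) (\<Delta>v :: real^'n) (\<Delta>b :: real^'n).
    ((A + \<Delta>A) + outer (u + \<Delta>u) (v + \<Delta>v)) *v x = b + \<Delta>b + \<Delta>F *v y \<and>
    mnorm \<Delta>A \<le> (k * k * (1 + c * eps) - 1) * mnorm A \<and>
    norm \<Delta>u \<le> c * eps * norm u \<and>
    norm \<Delta>v \<le> (g * (k * k) - 1) * norm v \<and>
    norm \<Delta>b \<le> c * eps * norm b \<and>
    mnorm \<Delta>F \<le> (k * (1 + c * eps) - 1 + c * eps) * mnorm A +
      (1 + c * eps) * ((1 + eps) * k * g + g * k - 2) * (norm u * norm v)"
proof -
  obtain E\<^sub>1 E\<^sub>2 :: "real^'n^'n" and \<Delta>b \<Delta>u d\<^sub>a d\<^sub>p d\<^sub>w d\<^sub>x :: "real^'n" and \<rho> \<theta> :: real where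
    y: "(A + E\<^sub>1) *v y = b + \<Delta>b" and
    z: "(A + E\<^sub>2) *v (d\<^sub>w * (y - d\<^sub>x * x)) = \<theta> *\<^sub>R (u + \<Delta>u)" and
    \<theta>: "\<theta> = \<rho> * (v \<bullet> (d\<^sub>a * y)) - v \<bullet> (d\<^sub>p * (d\<^sub>w * (y - d\<^sub>x * x)))" and
    E\<^sub>1: "mnorm E\<^sub>1 \<le> c * eps * mnorm A" and E\<^sub>2: "mnorm E\<^sub>2 \<le> c * eps * mnorm A" and
    \<Delta>b: "norm \<Delta>b \<le> c * eps * norm b" and \<Delta>u: "norm \<Delta>u \<le> c * eps * norm u" and
    \<rho>: "\<bar>\<rho> - 1\<bar> \<le> (1 + eps) * k - 1" and
    d\<^sub>a: "\<And>i. \<bar>d\<^sub>a $ i - 1\<bar> \<le> g - 1" and d\<^sub>p: "\<And>i. \<bar>d\<^sub>p $ i - 1\<bar> \<le> g - 1" and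
    d\<^sub>w: "\<And>i. \<bar>d\<^sub>w $ i - 1\<bar> \<le> k - 1" and d\<^sub>x: "\<And>i. \<bar>d\<^sub>x $ i - 1\<bar> \<le> k - 1"
    using SM_computedE[OF assms(3-5)] unfolding k_def g_def by metis
  \<comment> \<open>Splitting \<theta> into its \<open>x\<close> and \<open>y\<close> parts gives
    \<open>v + \<Delta>v\<close> as the weight of \<open>x\<close> and \<open>h * v\<close> as the
    weight of \<open>y\<close>. \<open>\<Delta>F\<close> is what remains on \<open>y\<close> after
    subtracting \<open>A + E\<^sub>1\<close>, which accounts for
    \<open>b + \<Delta>b\<close>.\<close>
  define h where "h = \<rho> *\<^sub>R d\<^sub>a - d\<^sub>p * d\<^sub>w"
  define \<Delta>A where "\<Delta>A = scale_cols (A + E\<^sub>2) (d\<^sub>w * d\<^sub>x) - A"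
  define \<Delta>v where "\<Delta>v = (d\<^sub>p * (d\<^sub>w * d\<^sub>x) - 1) * v"
  define \<Delta>F where "\<Delta>F = scale_cols (A + E\<^sub>2) d\<^sub>w - A - E\<^sub>1 - outer (u + \<Delta>u) (h * v)"

  \<comment> \<open>Used with \<open>K = k * k\<close> for \<open>\<Delta>A\<close> and with
    \<open>K = k\<close> for \<open>\<Delta>F\<close>. Only the part from \<open>A\<close> is
    compared with its unscaled value; \<open>E\<^sub>2\<close> is already of first order.\<close>
  have scale_le: "mnorm (scale_cols (A + E\<^sub>2) d - A) \<le> (K * (1 + c * eps) - 1) * mnorm A"
    if d: "\<And>i. \<bar>d $ i - 1\<bar> \<le> K - 1" for d K
  proof -
    have abs_d: "\<bar>d $ i\<bar> \<le> K" for i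
      using d[of i] by linarith
    have "0 \<le> K"
      using abs_d[of undefined] by linarith
    have "scale_cols (A + E\<^sub>2) d - A = scale_cols A (d - 1) + scale_cols E\<^sub>2 d"
      by (simp add: scale_cols_add_left flip: scale_cols_minus_self)
    then have "mnorm (scale_cols (A + E\<^sub>2) d - A) \<le>
        mnorm (scale_cols A (d - 1)) + mnorm (scale_cols E\<^sub>2 d)"
      by (simp add: mnorm_add_le)
    also have "\<dots> \<le> (K - 1) * mnorm A + K * mnorm E\<^sub>2"
      by (intro add_mono mnorm_scale_cols_le) (use d abs_d in auto)
    also have "\<dots> \<le> (K - 1) * mnorm A + K * (c * eps * mnorm A)"
      using E\<^sub>2 \<open>0 \<le> K\<close> by (intro add_left_mono mult_left_mono)
    finally show ?thesis
      by (simp add: algebra_simps)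
  qed

  have d\<^sub>w\<^sub>x: "\<bar>(d\<^sub>w * d\<^sub>x) $ i - 1\<bar> \<le> k * k - 1" for i
    using abs_mult_minus_one_le[OF d\<^sub>w d\<^sub>x] by simp
  have \<Delta>A: "mnorm \<Delta>A \<le> (k * k * (1 + c * eps) - 1) * mnorm A"
    unfolding \<Delta>A_def by (rule scale_le) (rule d\<^sub>w\<^sub>x)
  have \<Delta>v: "norm \<Delta>v \<le> (g * (k * k) - 1) * norm v"
    unfolding \<Delta>v_def
    by (rule norm_times_vec_le) (use abs_mult_minus_one_le[OF d\<^sub>p d\<^sub>w\<^sub>x] in simp)

  \<comment> \<open>\<open>h\<close> is a difference of two factors near 1, so the ones cancel and
    the two deviations add up; hence the \<open>- 2\<close>.\<close>
  have "\<bar>h $ i\<bar> \<le> (1 + eps) * k * g + g * k - 2" for i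
    using abs_mult_minus_one_le[OF \<rho> d\<^sub>a[of i]] abs_mult_minus_one_le[OF d\<^sub>p[of i] d\<^sub>w[of i]]
    by (simp add: h_def)
  then have "norm (h * v) \<le> ((1 + eps) * k * g + g * k - 2) * norm v"
    by (rule norm_times_vec_le)
  moreover have "norm (u + \<Delta>u) \<le> (1 + c * eps) * norm u"
    using norm_triangle_ineq[of u \<Delta>u] \<Delta>u by (simp add: algebra_simps)
  ultimately have "norm (u + \<Delta>u) * norm (h * v) \<le>
      ((1 + c * eps) * norm u) * (((1 + eps) * k * g + g * k - 2) * norm v)"
    by (intro mult_mono') auto
  then have outer_le: "mnorm (outer (u + \<Delta>u) (h * v)) \<le>
      (1 + c * eps) * ((1 + eps) * k * g + g * k - 2) * (norm u * norm v)"
    using mnorm_outer_le[of "u + \<Delta>u" "h * v"] by (simp add: mult_ac)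
  have "mnorm \<Delta>F \<le> mnorm (scale_cols (A + E\<^sub>2) d\<^sub>w - A) + mnorm E\<^sub>1 +
      mnorm (outer (u + \<Delta>u) (h * v))"
    unfolding \<Delta>F_def by (meson mnorm_diff_le add_right_mono order_trans)
  also have "\<dots> \<le> (k * (1 + c * eps) - 1) * mnorm A + c * eps * mnorm A +
      (1 + c * eps) * ((1 + eps) * k * g + g * k - 2) * (norm u * norm v)"
    by (intro add_mono scale_le d\<^sub>w E\<^sub>1 outer_le)
  finally have \<Delta>F: "mnorm \<Delta>F \<le> (k * (1 + c * eps) - 1 + c * eps) * mnorm A +
      (1 + c * eps) * ((1 + eps) * k * g + g * k - 2) * (norm u * norm v)"
    by (simp add: algebra_simps)

  have v_inner: "(v + \<Delta>v) \<bullet> x = v \<bullet> (d\<^sub>p * (d\<^sub>w * (d\<^sub>x * x)))"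
    by (simp add: \<Delta>v_def inner_vec_def algebra_simps)
  have h_inner: "(h * v) \<bullet> y = \<rho> * (v \<bullet> (d\<^sub>a * y)) - v \<bullet> (d\<^sub>p * (d\<^sub>w * y))"
    by (simp add: h_def inner_vec_def algebra_simps sum_subtractf sum_distrib_left)
  have split: "f * (y - d\<^sub>x * x) = f * y - f * (d\<^sub>x * x)" for f :: "real^'n"
    by (simp add: vec_eq_iff algebra_simps)
  have \<theta>_split: "\<theta> = (h * v) \<bullet> y + (v + \<Delta>v) \<bullet> x"
    unfolding \<theta> v_inner h_inner
    by (simp add: inner_vec_def algebra_simps sum_subtractf)
  have "A + \<Delta>A = scale_cols (A + E\<^sub>2) (d\<^sub>w * d\<^sub>x)"
    by (simp add: \<Delta>A_def)
  then have "(A + \<Delta>A) *v x = (A + E\<^sub>2) *v (d\<^sub>w * (d\<^sub>x * x))"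
    by (simp add: scale_cols_mult_vec mult.assoc)
  also have "\<dots> = (A + E\<^sub>2) *v (d\<^sub>w * y) - \<theta> *\<^sub>R (u + \<Delta>u)"
    unfolding z[symmetric] split by (simp add: matrix_vector_mult_diff_distrib)
  \<comment> \<open>The rank-one term cancels the \<open>x\<close> part of
    \<open>\<theta> *\<^sub>R (u + \<Delta>u)\<close>, leaving terms in \<open>y\<close>
    only.\<close>
  finally have lhs: "((A + \<Delta>A) + outer (u + \<Delta>u) (v + \<Delta>v)) *v x =
      (A + E\<^sub>2) *v (d\<^sub>w * y) - ((h * v) \<bullet> y) *\<^sub>R (u + \<Delta>u)"
    unfolding \<theta>_split
    by (simp add: matrix_vector_mult_add_rdistrib outer_mult_vec scaleR_add_left)
  have "b + \<Delta>b + \<Delta>F *v y = (A + E\<^sub>2) *v (d\<^sub>w * y) - ((h * v) \<bullet> y) *\<^sub>R (u + \<Delta>u)"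
    unfolding y[symmetric] \<Delta>F_def
    by (simp add: matrix_vector_mult_add_rdistrib matrix_vector_mult_diff_rdistrib
        outer_mult_vec scale_cols_mult_vec)
  with lhs have "((A + \<Delta>A) + outer (u + \<Delta>u) (v + \<Delta>v)) *v x = b + \<Delta>b + \<Delta>F *v y"
    by simp
  with \<Delta>A \<Delta>u \<Delta>v \<Delta>b \<Delta>F show ?thesis
    by blast
qed

text \<open>The remainders are chosen before \<open>\<epsilon>\<close>, \<open>y\<close> and
  \<open>x\<close>, so the second-order terms are uniform over all rounding errors.\<close>

theorem theorem2p1:
  fixes A :: "real^'n^'n" and u v b :: "real^'n" and c\<^sub>s :: real
  assumes "invertible A"
    and "invertible (A + outer u v)"
  shows "\<exists>\<phi>\<^sub>A \<phi>\<^sub>v \<phi>\<^sub>F :: real \<Rightarrow> real.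
    \<phi>\<^sub>A \<in> O[at_right 0](\<lambda>\<epsilon>. \<epsilon>^2) \<and>
    \<phi>\<^sub>v \<in> O[at_right 0](\<lambda>\<epsilon>. \<epsilon>^2) \<and>
    \<phi>\<^sub>F \<in> O[at_right 0](\<lambda>\<epsilon>. \<epsilon>^2) \<and>
    (\<forall>\<epsilon> y x. 0 < \<epsilon> \<longrightarrow> real CARD('n) * \<epsilon> < 1 \<longrightarrow> SM_computed c\<^sub>s \<epsilon> A u v b y x \<longrightarrow>
      (\<exists>(\<Delta>A :: real^'n^'n) (\<Delta>F :: real^'n^'n) (\<Delta>u :: real^'n) (\<Delta>v :: real^'n) (\<Delta>b :: real^'n).
        ((A + \<Delta>A) + outer (u + \<Delta>u) (v + \<Delta>v)) *v x = b + \<Delta>b + \<Delta>F *v y \<and>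
        mnorm \<Delta>A \<le> ((2 + c\<^sub>s) * \<epsilon> + \<phi>\<^sub>A \<epsilon>) * mnorm A \<and>
        norm \<Delta>u \<le> c\<^sub>s * \<epsilon> * norm u \<and>
        norm \<Delta>v \<le> ((real CARD('n) + 2) * \<epsilon> + \<phi>\<^sub>v \<epsilon>) * norm v \<and>
        norm \<Delta>b \<le> c\<^sub>s * \<epsilon> * norm b \<and>
        mnorm \<Delta>F \<le> \<epsilon> * ((2 * c\<^sub>s + 1) * mnorm A + (2 * real CARD('n) + 3) * norm u * norm v)
                     + \<phi>\<^sub>F \<epsilon>))"
proof -
  define N where "N = real CARD('n)"
  \<comment> \<open>Each remainder is an explicit bound minus its linear part. To first order
    \<open>k\<close> adds 1, \<open>g\<close> adds \<open>N\<close> and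
    \<open>1 + c\<^sub>s * \<epsilon>\<close> adds \<open>c\<^sub>s\<close>. In
    \<open>\<psi>\<^sub>2\<close> the bracket gives \<open>(N + 2) + (N + 1) = 2 * N + 3\<close>;
    being of first order itself, it gains only second-order terms from the factor
    \<open>1 + c\<^sub>s * \<epsilon>\<close>.\<close>
  define \<phi>\<^sub>A where "\<phi>\<^sub>A \<epsilon> = 1 / (1 - \<epsilon>) * (1 / (1 - \<epsilon>)) * (1 + c\<^sub>s * \<epsilon>) - 1 - (2 + c\<^sub>s) * \<epsilon>"
    for \<epsilon> :: real
  define \<phi>\<^sub>v where "\<phi>\<^sub>v \<epsilon> = 1 / (1 - N * \<epsilon>) * (1 / (1 - \<epsilon>) * (1 / (1 - \<epsilon>))) - 1 - (N + 2) * \<epsilon>"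
    for \<epsilon> :: real
  define \<psi>\<^sub>1 where "\<psi>\<^sub>1 \<epsilon> = 1 / (1 - \<epsilon>) * (1 + c\<^sub>s * \<epsilon>) - 1 + c\<^sub>s * \<epsilon> - (2 * c\<^sub>s + 1) * \<epsilon>"
    for \<epsilon> :: real
  define \<psi>\<^sub>2 where "\<psi>\<^sub>2 \<epsilon> = (1 + c\<^sub>s * \<epsilon>) * ((1 + \<epsilon>) * (1 / (1 - \<epsilon>)) * (1 / (1 - N * \<epsilon>)) +
      1 / (1 - N * \<epsilon>) * (1 / (1 - \<epsilon>)) - 2) - (2 * N + 3) * \<epsilon>"
    for \<epsilon> :: real
  define \<phi>\<^sub>F where "\<phi>\<^sub>F \<epsilon> = \<psi>\<^sub>1 \<epsilon> * mnorm A + \<psi>\<^sub>2 \<epsilon> * (norm u * norm v)" for \<epsilon>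
  have A: "\<phi>\<^sub>A \<in> O[at_right 0](\<lambda>\<epsilon>. \<epsilon>^2)"
    unfolding \<phi>\<^sub>A_def by real_asymp
  have v: "\<phi>\<^sub>v \<in> O[at_right 0](\<lambda>\<epsilon>. \<epsilon>^2)"
    unfolding \<phi>\<^sub>v_def by real_asymp
  have \<psi>: "\<psi>\<^sub>1 \<in> O[at_right 0](\<lambda>\<epsilon>. \<epsilon>^2)" "\<psi>\<^sub>2 \<in> O[at_right 0](\<lambda>\<epsilon>. \<epsilon>^2)"
    unfolding \<psi>\<^sub>1_def \<psi>\<^sub>2_def by real_asymp+
  have F: "\<phi>\<^sub>F \<in> O[at_right 0](\<lambda>\<epsilon>. \<epsilon>^2)"
    unfolding \<phi>\<^sub>F_def
    by (intro sum_in_bigo) (simp_all add: \<psi>)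
  have "1 / (1 - \<epsilon>) * (1 / (1 - \<epsilon>)) * (1 + c\<^sub>s * \<epsilon>) - 1 = (2 + c\<^sub>s) * \<epsilon> + \<phi>\<^sub>A \<epsilon>"
    and "1 / (1 - N * \<epsilon>) * (1 / (1 - \<epsilon>) * (1 / (1 - \<epsilon>))) - 1 = (N + 2) * \<epsilon> + \<phi>\<^sub>v \<epsilon>"
    and "(1 / (1 - \<epsilon>) * (1 + c\<^sub>s * \<epsilon>) - 1 + c\<^sub>s * \<epsilon>) * mnorm A +
      (1 + c\<^sub>s * \<epsilon>) * ((1 + \<epsilon>) * (1 / (1 - \<epsilon>)) * (1 / (1 - N * \<epsilon>)) +
        1 / (1 - N * \<epsilon>) * (1 / (1 - \<epsilon>)) - 2) * (norm u * norm v) =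
      \<epsilon> * ((2 * c\<^sub>s + 1) * mnorm A + (2 * N + 3) * norm u * norm v) + \<phi>\<^sub>F \<epsilon>" for \<epsilon>
    unfolding \<phi>\<^sub>A_def \<phi>\<^sub>v_def \<phi>\<^sub>F_def \<psi>\<^sub>1_def \<psi>\<^sub>2_def by (simp_all add: algebra_simps)
  note bounds = this[unfolded N_def]
  show ?thesis
    by (rule exI[of _ \<phi>\<^sub>A], rule exI[of _ \<phi>\<^sub>v], rule exI[of _ \<phi>\<^sub>F], intro conjI A v F allI impI)
      (rule SM_backward_error[where c = c\<^sub>s and A = A and u = u and v = v, unfolded bounds])
qed

end
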